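(* Let $(S,\circ)$ and $(S',\circ')$ be right loops, each of which has a transitive automorphism group. If $(S,\circ)$ and $(S',\circ')$ are isotopic, then they are isomorphic.
   Context: A right loop is a set $S$ with a binary operation $\circ$ having a two-sided identity $1$ and such that for all $a,b\in S$ the equation $X\circ a=b$ has a unique solution $X\in S$. Two right loops $(S,\circ)$ and $(S',\circ')$ are isotopic if there are bijections $\alpha,\beta,\gamma:S\to S'$ with $\alpha(x)\circ'\beta(y)=\gamma(x\circ y)$ for all $x,y\in S$; they are isomorphic if one can take $\alpha=\beta=\gamma$. An automorphism of $S$ is an isomorphism from $S$ to itself. A right loop has a transitive automorphism group if its automorphism group acts transitively on the set of non-identity elements $S\setminus\{1\}$. *)

theory Defs
  imports "HOL-Algebra.Group"
begin

text \<open>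
  The record type of \<^theory>\<open>HOL-Algebra.Group\<close> supplies only the signature (carrier,
  operation, unit); associativity is nowhere assumed. The library notions \<^const>\<open>hom\<close>,
  \<^const>\<open>iso\<close> and \<^const>\<open>is_iso\<close> depend on the carrier and the operation alone and so apply
  to right loops unchanged.
\<close>

locale right_loop =
  fixes S (structure)
  assumes m_closed: "\<lbrakk>x \<in> carrier S; y \<in> carrier S\<rbrakk> \<Longrightarrow> x \<otimes> y \<in> carrier S"
    and one_closed: "\<one> \<in> carrier S"
    and l_one: "x \<in> carrier S \<Longrightarrow> \<one> \<otimes> x = x"
    and r_one: "x \<in> carrier S \<Longrightarrow> x \<otimes> \<one> = x"
    and unique_solution:
      "\<lbrakk>a \<in> carrier S; b \<in> carrier S\<rbrakk> \<Longrightarrow> \<exists>!X. X \<in> carrier S \<and> X \<otimes> a = b"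

definition isotopism ::
  "('a, 'm) monoid_scheme \<Rightarrow> ('b, 'n) monoid_scheme \<Rightarrow>
    ('a \<Rightarrow> 'b) \<Rightarrow> ('a \<Rightarrow> 'b) \<Rightarrow> ('a \<Rightarrow> 'b) \<Rightarrow> bool"
  where "isotopism S S' \<alpha> \<beta> \<gamma> \<longleftrightarrow>
    bij_betw \<alpha> (carrier S) (carrier S') \<and>
    bij_betw \<beta> (carrier S) (carrier S') \<and>
    bij_betw \<gamma> (carrier S) (carrier S') \<and>
    (\<forall>x\<in>carrier S. \<forall>y\<in>carrier S. \<alpha> x \<otimes>\<^bsub>S'\<^esub> \<beta> y = \<gamma> (x \<otimes>\<^bsub>S\<^esub> y))"

definition isotopic :: "('a, 'm) monoid_scheme \<Rightarrow> ('b, 'n) monoid_scheme \<Rightarrow> bool"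
  where "isotopic S S' \<longleftrightarrow> (\<exists>\<alpha> \<beta> \<gamma>. isotopism S S' \<alpha> \<beta> \<gamma>)"

text \<open>
  The automorphisms of \<open>S\<close> are the elements of \<open>iso S S\<close>. For the one-element right loop, with no
  non-identity elements, the condition below holds vacuously.
\<close>

definition transitive_automorphism_group :: "('a, 'm) monoid_scheme \<Rightarrow> bool"
  where "transitive_automorphism_group S \<longleftrightarrow>
    (\<forall>x \<in> carrier S - {\<one>\<^bsub>S\<^esub>}. \<forall>y \<in> carrier S - {\<one>\<^bsub>S\<^esub>}. \<exists>\<phi> \<in> iso S S. \<phi> x = y)"

end

theory Submission
  imports Defs
begin

text \<open>
  An isotopism whose first two components both fix the identity is an isomorphism. Conjugating
  an automorphism of \<open>S\<close> by an isotopism \<open>(\<alpha>, \<beta>, \<gamma>)\<close> and composing with an automorphism of \<open>S'\<close>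
  replaces each component \<open>\<delta>\<close> by \<open>\<delta> \<circ> \<phi> \<circ> \<delta>\<inverse> \<circ> \<psi> \<circ> \<delta>\<close>. If \<open>\<delta> \<one> \<noteq> \<one>\<close> and some \<open>x \<noteq> \<one>\<close> has
  \<open>\<delta> x \<noteq> \<one>\<close>, then transitivity lets this carry \<open>\<one>\<close> along
  \<open>\<one> \<mapsto> \<delta> \<one> \<mapsto> \<delta> x \<mapsto> x \<mapsto> \<delta>\<inverse> \<one> \<mapsto> \<one>\<close>. Applied to \<open>\<alpha>\<close> and then to \<open>\<beta>\<close>, this normalizes both
  components, the second application leaving \<open>\<alpha> \<one> = \<one>\<close> intact since automorphisms fix \<open>\<one>\<close>.
  If \<open>\<delta> \<one> \<noteq> \<one>\<close> and no such \<open>x\<close> exists, \<open>S\<close> has two elements.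
\<close>

lemma isotopism_of_iso: "\<phi> \<in> iso S S' \<Longrightarrow> isotopism S S' \<phi> \<phi> \<phi>"
  by (auto simp: isotopism_def iso_def hom_def)

lemma isotopism_trans:
  assumes "isotopism S S' \<alpha> \<beta> \<gamma>" and "isotopism S' S'' \<alpha>' \<beta>' \<gamma>'"
  shows "isotopism S S'' (\<alpha>' \<circ> \<alpha>) (\<beta>' \<circ> \<beta>) (\<gamma>' \<circ> \<gamma>)"
  using assms unfolding isotopism_def
  by (auto intro: bij_betw_trans) (metis bij_betwE)

lemma (in right_loop) isotopism_sym:
  assumes "isotopism S S' \<alpha> \<beta> \<gamma>"
  shows "isotopism S' S (inv_into (carrier S) \<alpha>) (inv_into (carrier S) \<beta>)
    (inv_into (carrier S) \<gamma>)"
proof -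
  have bij: "bij_betw \<alpha> (carrier S) (carrier S')" "bij_betw \<beta> (carrier S) (carrier S')"
      "bij_betw \<gamma> (carrier S) (carrier S')"
    and mult: "\<And>x y. \<lbrakk>x \<in> carrier S; y \<in> carrier S\<rbrakk> \<Longrightarrow> \<alpha> x \<otimes>\<^bsub>S'\<^esub> \<beta> y = \<gamma> (x \<otimes>\<^bsub>S\<^esub> y)"
    using assms by (auto simp: isotopism_def)
  have "inv_into (carrier S) \<alpha> x \<otimes>\<^bsub>S\<^esub> inv_into (carrier S) \<beta> y
      = inv_into (carrier S) \<gamma> (x \<otimes>\<^bsub>S'\<^esub> y)"
    if "x \<in> carrier S'" "y \<in> carrier S'" for x y
  proof -
    let ?x = "inv_into (carrier S) \<alpha> x" and ?y = "inv_into (carrier S) \<beta> y"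
    have mem: "?x \<in> carrier S" "?y \<in> carrier S"
      using that bij(1,2) by (simp_all add: bij_betwE[OF bij_betw_inv_into])
    have "x \<otimes>\<^bsub>S'\<^esub> y = \<gamma> (?x \<otimes>\<^bsub>S\<^esub> ?y)"
      using mult[OF mem] that bij by (simp add: bij_betw_inv_into_right)
    then show ?thesis
      using bij(3) mem by (simp add: bij_betw_inv_into_left m_closed)
  qed
  then show ?thesis
    using bij by (simp add: isotopism_def bij_betw_inv_into)
qed

text \<open>The image of \<open>\<one>\<close> is idempotent, so it and the identity of
  \<open>S'\<close> both solve \<open>X \<otimes> \<phi> \<one> = \<phi> \<one>\<close>; uniqueness
  of the solution identifies them.\<close>

lemma (in right_loop) iso_one:
  assumes "right_loop S'" and "\<phi> \<in> iso S S'"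
  shows "\<phi> \<one> = \<one>\<^bsub>S'\<^esub>"
proof -
  interpret S': right_loop S' by fact
  have mem: "\<phi> \<one> \<in> carrier S'" and "\<phi> \<one> \<otimes>\<^bsub>S'\<^esub> \<phi> \<one> = \<phi> \<one>"
    using assms(2) one_closed l_one[OF one_closed]
    by (auto simp: iso_def hom_def Pi_iff) metis
  then show ?thesis
    using S'.unique_solution[OF mem mem] S'.l_one[OF mem] S'.one_closed by blast
qed

lemma is_iso_of_normalized_isotopism:
  assumes "right_loop S" and "right_loop S'" and iso: "isotopism S S' \<alpha> \<beta> \<gamma>"
    and \<alpha>1: "\<alpha> \<one>\<^bsub>S\<^esub> = \<one>\<^bsub>S'\<^esub>" and \<beta>1: "\<beta> \<one>\<^bsub>S\<^esub> = \<one>\<^bsub>S'\<^esub>"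
  shows "S \<cong> S'"
proof -
  interpret S: right_loop S by fact
  interpret S': right_loop S' by fact
  have bij: "bij_betw \<alpha> (carrier S) (carrier S')" "bij_betw \<beta> (carrier S) (carrier S')"
      "bij_betw \<gamma> (carrier S) (carrier S')"
    and mult: "\<And>x y. \<lbrakk>x \<in> carrier S; y \<in> carrier S\<rbrakk> \<Longrightarrow> \<alpha> x \<otimes>\<^bsub>S'\<^esub> \<beta> y = \<gamma> (x \<otimes>\<^bsub>S\<^esub> y)"
    using iso by (auto simp: isotopism_def)
  \<comment> \<open>Put the identity in the second argument of \<open>mult\<close> for \<alpha>, and
    in the first for \<beta>.\<close>
  have "\<alpha> x = \<gamma> x" "\<beta> x = \<gamma> x" if "x \<in> carrier S" for x
    using mult[OF that S.one_closed] mult[OF S.one_closed that] that bij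
    by (auto simp: \<alpha>1 \<beta>1 S.l_one S.r_one S'.l_one S'.r_one dest: bij_betwE)
  then have "\<gamma> \<in> iso S S'"
    using bij mult by (auto simp: iso_def hom_def dest: bij_betwE)
  then show ?thesis
    by (auto simp: is_iso_def)
qed

text \<open>The solution of \<open>X \<otimes> a = \<one>\<close> cannot be \<open>\<one>\<close>,
  since \<open>\<one> \<otimes> a = a\<close>; only \<open>a\<close> is left.\<close>

lemma (in right_loop) two_element_square:
  assumes carrier: "carrier S = {\<one>, a}" and "a \<noteq> \<one>"
  shows "a \<otimes> a = \<one>"
proof -
  obtain X where "X \<in> carrier S" "X \<otimes> a = \<one>"
    using unique_solution[of a \<one>] carrier by blast
  then show ?thesis
    using carrier \<open>a \<noteq> \<one>\<close> l_one[of a] by auto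
qed

text \<open>The identity laws fix three entries of each multiplication table and
  \<open>two_element_square\<close> the fourth, so the bijection matching identities is
  multiplicative.\<close>

lemma two_element_right_loops_iso:
  assumes "right_loop S" and "right_loop S'"
    and "carrier S = {\<one>\<^bsub>S\<^esub>, a}" and "a \<noteq> \<one>\<^bsub>S\<^esub>"
    and "carrier S' = {\<one>\<^bsub>S'\<^esub>, b}" and "b \<noteq> \<one>\<^bsub>S'\<^esub>"
  shows "S \<cong> S'"
proof -
  interpret S: right_loop S by fact
  interpret S': right_loop S' by fact
  define f where "f x = (if x = a then b else \<one>\<^bsub>S'\<^esub>)" for x
  have "bij_betw f (carrier S) (carrier S')"
    using assms(3-6) by (auto simp: bij_betw_def f_def)
  moreover have "f \<in> hom S S'"
    using assms(3-6) S.two_element_square S'.two_element_square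
    by (auto simp: hom_def f_def S.l_one S.r_one S'.l_one S'.r_one)
  ultimately show ?thesis
    by (auto simp: is_iso_def iso_def)
qed

lemma exists_normalizing_automorphisms:
  assumes "right_loop S"
    and "transitive_automorphism_group S" and "transitive_automorphism_group S'"
    and \<delta>: "bij_betw \<delta> (carrier S) (carrier S')" and one: "\<one>\<^bsub>S'\<^esub> \<in> carrier S'"
    and \<delta>1: "\<delta> \<one>\<^bsub>S\<^esub> \<noteq> \<one>\<^bsub>S'\<^esub>"
    and x: "x \<in> carrier S" "x \<noteq> \<one>\<^bsub>S\<^esub>" "\<delta> x \<noteq> \<one>\<^bsub>S'\<^esub>"
  obtains \<phi> \<psi> where "\<phi> \<in> iso S S" "\<psi> \<in> iso S' S'"
    and "(\<delta> \<circ> \<phi> \<circ> inv_into (carrier S) \<delta> \<circ> \<psi> \<circ> \<delta>) \<one>\<^bsub>S\<^esub> = \<one>\<^bsub>S'\<^esub>"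
proof -
  interpret S: right_loop S by fact
  obtain a where a: "a \<in> carrier S" "\<delta> a = \<one>\<^bsub>S'\<^esub>"
    using \<delta> one by (metis bij_betw_iff_bijections)
  \<comment> \<open>Transitivity applies because \<open>a\<close> is not the identity: \<delta>
    sends \<open>a\<close> to the identity of \<open>S'\<close>, but not the identity of
    \<open>S\<close>.\<close>
  obtain \<phi> where "\<phi> \<in> iso S S" "\<phi> x = a"
    using assms(2) a x \<delta>1 unfolding transitive_automorphism_group_def by blast
  moreover obtain \<psi> where "\<psi> \<in> iso S' S'" "\<psi> (\<delta> \<one>\<^bsub>S\<^esub>) = \<delta> x"
    using assms(3) x \<delta>1 bij_betwE[OF \<delta>] S.one_closed
    unfolding transitive_automorphism_group_def by blast
  ultimately show thesis
    using that a x(1) \<delta> by (simp add: bij_betw_inv_into_left)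
qed

theorem theorem2p14:
  fixes S :: "('a, 'm) monoid_scheme" and S' :: "('b, 'n) monoid_scheme"
  assumes "right_loop S" and "right_loop S'"
    and "transitive_automorphism_group S" and "transitive_automorphism_group S'"
    and "isotopic S S'"
  shows "S \<cong> S'"
proof -
  interpret S: right_loop S by fact
  interpret S': right_loop S' by fact
  let ?one = "\<one>\<^bsub>S\<^esub>" and ?one' = "\<one>\<^bsub>S'\<^esub>"
  let ?conj = "\<lambda>\<phi> \<psi> \<delta>. \<delta> \<circ> \<phi> \<circ> inv_into (carrier S) \<delta> \<circ> \<psi> \<circ> \<delta>"
  \<comment> \<open>An automorphism is an isotopism with three equal components, so one pair \<phi>,
    \<psi> serves all three components at once.\<close>
  have conj: "isotopism S S' (?conj \<phi> \<psi> \<alpha>) (?conj \<phi> \<psi> \<beta>) (?conj \<phi> \<psi> \<gamma>)"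
    if "isotopism S S' \<alpha> \<beta> \<gamma>" "\<phi> \<in> iso S S" "\<psi> \<in> iso S' S'" for \<phi> \<psi> \<alpha> \<beta> \<gamma>
    using isotopism_trans[OF that(1) isotopism_trans[OF isotopism_of_iso[OF that(3)]
      isotopism_trans[OF S.isotopism_sym[OF that(1)]
      isotopism_trans[OF isotopism_of_iso[OF that(2)] that(1)]]]]
    by (simp add: comp_assoc)
  show ?thesis
  proof (cases "\<exists>a. a \<noteq> ?one \<and> carrier S = {?one, a}")
    case True
    then obtain a where a: "carrier S = {?one, a}" "a \<noteq> ?one" by blast
    obtain \<alpha> where \<alpha>: "bij_betw \<alpha> (carrier S) (carrier S')"
      using assms(5) by (auto simp: isotopic_def isotopism_def)
    have "card (carrier S') = 2"
      using bij_betw_same_card[OF \<alpha>] a by simp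
    then obtain b where "carrier S' = {?one', b}" "b \<noteq> ?one'"
      using S'.one_closed by (auto simp: card_2_iff doubleton_eq_iff)
    with a assms(1,2) show ?thesis
      by (intro two_element_right_loops_iso)
  next
    case False
    have third: "\<exists>x\<in>carrier S. x \<noteq> ?one \<and> \<delta> x \<noteq> ?one'"
      if \<delta>: "bij_betw \<delta> (carrier S) (carrier S')" and \<delta>1: "\<delta> ?one \<noteq> ?one'" for \<delta>
    proof -
      obtain a where a: "a \<in> carrier S" "\<delta> a = ?one'"
        using \<delta> S'.one_closed by (metis bij_betw_iff_bijections)
      then have "a \<noteq> ?one" using \<delta>1 by blast
      \<comment> \<open>The identity and \<open>a\<close> are distinct and, outside the two-element
        case, do not exhaust \<open>S\<close>.\<close>
      then obtain x where x: "x \<in> carrier S" "x \<noteq> ?one" "x \<noteq> a"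
        using False a S.one_closed by blast
      with a have "\<delta> x \<noteq> ?one'"
        using inj_onD[OF bij_betw_imp_inj_on[OF \<delta>], of x a] by auto
      with x show ?thesis by blast
    qed
    obtain \<alpha> \<beta> \<gamma> where iso: "isotopism S S' \<alpha> \<beta> \<gamma>" and \<alpha>1: "\<alpha> ?one = ?one'"
    proof -
      obtain \<alpha> \<beta> \<gamma> where iso: "isotopism S S' \<alpha> \<beta> \<gamma>"
        using assms(5) by (auto simp: isotopic_def)
      then have bij: "bij_betw \<alpha> (carrier S) (carrier S')" by (simp add: isotopism_def)
      show thesis
      proof (cases "\<alpha> ?one = ?one'")
        case True
        with iso that show ?thesis by blast
      next
        case False
        with third[OF bij] obtain x
          where x: "x \<in> carrier S" "x \<noteq> ?one" "\<alpha> x \<noteq> ?one'" by blast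
        obtain \<phi> \<psi> where "\<phi> \<in> iso S S" "\<psi> \<in> iso S' S'" "?conj \<phi> \<psi> \<alpha> ?one = ?one'"
          by (rule exists_normalizing_automorphisms[OF assms(1,3,4) bij S'.one_closed False x])
        with conj[OF iso] that show ?thesis by blast
      qed
    qed
    then have bij: "bij_betw \<alpha> (carrier S) (carrier S')" "bij_betw \<beta> (carrier S) (carrier S')"
      by (simp_all add: isotopism_def)
    show ?thesis
    proof (cases "\<beta> ?one = ?one'")
      case True
      with iso \<alpha>1 assms(1,2) show ?thesis by (intro is_iso_of_normalized_isotopism)
    next
      case False
      with third[OF bij(2)] obtain x
        where x: "x \<in> carrier S" "x \<noteq> ?one" "\<beta> x \<noteq> ?one'" by blast
      \<comment> \<open>The pair is chosen for \<beta>; its effect on \<alpha> is checked next, each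
        factor of the conjugate sending identity to identity.\<close>
      obtain \<phi> \<psi> where aut: "\<phi> \<in> iso S S" "\<psi> \<in> iso S' S'" and "?conj \<phi> \<psi> \<beta> ?one = ?one'"
        by (rule exists_normalizing_automorphisms[OF assms(1,3,4) bij(2) S'.one_closed False x])
      moreover have "inv_into (carrier S) \<alpha> ?one' = ?one"
        using bij_betw_inv_into_left[OF bij(1) S.one_closed] by (simp add: \<alpha>1)
      then have "?conj \<phi> \<psi> \<alpha> ?one = ?one'"
        using S.iso_one[OF assms(1) aut(1)] S'.iso_one[OF assms(2) aut(2)] by (simp add: \<alpha>1)
      ultimately show ?thesis
        using is_iso_of_normalized_isotopism[OF assms(1,2) conj[OF iso aut]] by blast
    qed
  qed
qed

end
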